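(* For all integers $\sigma \ge 0$ and $n \ge 0$, $$G_\sigma(n) = \sum_{k=n}^{(\sigma+1)n} S_2^{(\sigma+1)}(k,n).$$
   Context: Gift exchange game with steal limit $\sigma\ge 0$ and $m\ge 1$ gifts: there are $m$ players and $m$ distinct wrapped gifts, initially all in a pool. The players are called one at a time in a fixed order. When a player is called, and also whenever a player's gift has just been stolen, that player (who currently holds no gift) makes a move: either take one of the gifts still in the pool (it is unwrapped and held by that player), or steal an unwrapped gift currently held by another player, provided this gift has so far been stolen fewer than $\sigma$ times in total; the player from whom it was stolen then immediately makes a move. The game ends as soon as the last gift in the pool is taken. A scenario is the complete sequence of moves (which player took which gift at each move). For $n\ge 0$, $G_\sigma(n)$ is the number of scenarios of the game with $m=n+1$ gifts in which the gifts are taken from the pool in the order $1,2,\ldots,n+1$ (equivalently, $1/(n+1)!$ times the total number of scenarios). For $h\ge1$, $S_2^{(h)}(k,n)$ denotes the number of partitions of the set $\{1,\ldots,k\}$ into exactly $n$ nonempty blocks, each of size at most $h$ (with $S_2^{(h)}(0,0)=1$). *)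

theory Defs
  imports Main "HOL-Library.Disjoint_Sets"
begin

text \<open>In a game with \<open>m\<close> gifts, both players and gifts are numbered \<open>1, \<dots>, m\<close>; the players are
  called in the order \<open>1, 2, \<dots>, m\<close>.\<close>

text \<open>A move names the player who moves and the gift that player takes. Whether the gift comes from
  the pool or from another player is determined by the preceding moves, so recording
  this in the constructor does not change the number of scenarios.\<close>

datatype move = Take (player: nat) (gift: nat) | Steal (player: nat) (gift: nat)

text \<open>\<open>called\<close> is the number of players called so far, \<open>mover\<close> the player who has to move next
  (and holds no gift). A gift is in the pool iff its \<open>holder\<close> is \<^const>\<open>None\<close>. Once the
  pool is empty the game is over and \<open>mover\<close> and \<open>called\<close> have no meaning.\<close>

record game_state =
  called :: nat
  mover :: nat
  holder :: "nat \<Rightarrow> nat option"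
  steals :: "nat \<Rightarrow> nat"

definition initial_state :: game_state where
  "initial_state = \<lparr>called = 1, mover = 1, holder = (\<lambda>_. None), steals = (\<lambda>_. 0)\<rparr>"

definition pool :: "nat \<Rightarrow> game_state \<Rightarrow> nat set" where
  "pool m s = {g \<in> {1..m}. holder s g = None}"

definition after_take :: "nat \<Rightarrow> game_state \<Rightarrow> game_state" where
  "after_take g s =
     s\<lparr>called := called s + 1, mover := called s + 1, holder := (holder s)(g := Some (mover s))\<rparr>"

definition after_steal :: "nat \<Rightarrow> nat \<Rightarrow> game_state \<Rightarrow> game_state" where
  "after_steal g victim s =
     s\<lparr>mover := victim, holder := (holder s)(g := Some (mover s)),
       steals := (steals s)(g := steals s g + 1)\<rparr>"

text \<open>\<open>complete_play \<sigma> m s ms\<close>: starting in state \<open>s\<close>, the sequence \<open>ms\<close> of moves is legal and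
  leads to the end of the game.\<close>

inductive complete_play :: "nat \<Rightarrow> nat \<Rightarrow> game_state \<Rightarrow> move list \<Rightarrow> bool" for \<sigma> m :: nat where
  over: "pool m s = {} \<Longrightarrow> complete_play \<sigma> m s []"
| take: "\<lbrakk>g \<in> pool m s; complete_play \<sigma> m (after_take g s) ms\<rbrakk>
    \<Longrightarrow> complete_play \<sigma> m s (Take (mover s) g # ms)"
| steal: "\<lbrakk>pool m s \<noteq> {}; g \<in> {1..m}; holder s g = Some victim; victim \<noteq> mover s; steals s g < \<sigma>;
      complete_play \<sigma> m (after_steal g victim s) ms\<rbrakk>
    \<Longrightarrow> complete_play \<sigma> m s (Steal (mover s) g # ms)"

definition scenarios :: "nat \<Rightarrow> nat \<Rightarrow> move list set" where
  "scenarios \<sigma> m = {ms. complete_play \<sigma> m initial_state ms}"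

definition pool_order :: "move list \<Rightarrow> nat list" where
  "pool_order ms = map gift (filter is_Take ms)"

definition G :: "nat \<Rightarrow> nat \<Rightarrow> nat" where
  "G \<sigma> n = card {ms \<in> scenarios \<sigma> (n + 1). pool_order ms = [1..<n + 2]}"

definition S2 :: "nat \<Rightarrow> nat \<Rightarrow> nat \<Rightarrow> nat" where
  "S2 h k n = card {P. partition_on {1..k} P \<and> card P = n \<and> (\<forall>B\<in>P. card B \<le> h)}"

end

theory Submission imports Defs begin

text \<open>A player who moves holds no gift, so a scenario is determined by the word of gifts taken, and
  every gift already unwrapped and stolen fewer than \<open>\<sigma>\<close> times is available. Deleting the final
  letter \<open>n + 1\<close>, the scenarios become the words in which the letters \<open>1, \<dots>, n\<close> appear
  for the first time in this order, each occurring between \<open>1\<close> and \<open>\<sigma> + 1\<close> times. Such a word of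
  length \<open>k\<close> corresponds to the partition of its \<open>k\<close> positions by letters, the blocks being labelled
  in the order of their minima.\<close>

section \<open>Scenarios as words of gifts\<close>

text \<open>Inverse of \<open>map gift\<close> on complete plays: \<open>holder\<close> tells a take
  from a steal, and the state supplies the mover.\<close>

primrec play :: "game_state \<Rightarrow> nat list \<Rightarrow> move list" where
  "play s [] = []"
| "play s (g # w) = (case holder s g of
      None \<Rightarrow> Take (mover s) g # play (after_take g s) w
    | Some p \<Rightarrow> Steal (mover s) g # play (after_steal g p s) w)"

lemma map_gift_play [simp]: "map gift (play s w) = w"
  by (induction w arbitrary: s) (auto split: option.split)

lemma complete_play_eq_play:
  assumes "complete_play \<sigma> m s ms"
  shows "ms = play s (map gift ms)"
  using assms by induction (auto simp: pool_def)

text \<open>Here \<open>t\<close> is the number of gifts already unwrapped, and \<open>c\<close> counts the steals of each gift.\<close>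

primrec legal :: "nat \<Rightarrow> nat \<Rightarrow> nat \<Rightarrow> (nat \<Rightarrow> nat) \<Rightarrow> nat list \<Rightarrow> bool" where
  "legal \<sigma> m t c [] \<longleftrightarrow> t = m"
| "legal \<sigma> m t c (g # w) \<longleftrightarrow> t < m \<and>
     (g = Suc t \<and> legal \<sigma> m (Suc t) c w \<or>
      0 < g \<and> g \<le> t \<and> c g < \<sigma> \<and> legal \<sigma> m t (c(g := c g + 1)) w)"

text \<open>An invariant of the game states with \<open>t\<close> gifts unwrapped. Bounding all
  holders by \<open>called s\<close> guarantees that the next player to be called holds no gift
  yet.\<close>

definition reachable :: "nat \<Rightarrow> game_state \<Rightarrow> bool" where
  "reachable t s \<longleftrightarrow> (\<forall>g. holder s g \<noteq> None \<longleftrightarrow> 0 < g \<and> g \<le> t) \<and> mover s \<le> called s \<and>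
     (\<forall>g p. holder s g = Some p \<longrightarrow> p \<le> called s \<and> p \<noteq> mover s) \<and>
     inj_on (holder s) {1..t}"

inductive_cases complete_play_NilE: "complete_play \<sigma> m s []"
inductive_cases complete_play_TakeE: "complete_play \<sigma> m s (Take p g # ms)"
inductive_cases complete_play_StealE: "complete_play \<sigma> m s (Steal p g # ms)"

lemma complete_play_Nil: "complete_play \<sigma> m s [] \<longleftrightarrow> pool m s = {}"
  by (auto intro: complete_play.over elim: complete_play_NilE)

lemma complete_play_Take:
  "complete_play \<sigma> m s (Take p g # ms) \<longleftrightarrow>
     p = mover s \<and> g \<in> pool m s \<and> complete_play \<sigma> m (after_take g s) ms"
  by (auto intro: complete_play.take elim: complete_play_TakeE)

lemma complete_play_Steal:
  "complete_play \<sigma> m s (Steal p g # ms) \<longleftrightarrow>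
     p = mover s \<and> pool m s \<noteq> {} \<and> g \<in> {1..m} \<and> steals s g < \<sigma> \<and>
     (\<exists>v. holder s g = Some v \<and> v \<noteq> mover s \<and> complete_play \<sigma> m (after_steal g v s) ms)"
  by (auto intro: complete_play.steal elim: complete_play_StealE)

lemma pool_reachable:
  assumes "reachable t s"
  shows "pool m s = {t<..m}"
proof -
  have "holder s g = None \<longleftrightarrow> \<not> (0 < g \<and> g \<le> t)" for g
    using assms unfolding reachable_def by blast
  then show ?thesis
    by (auto simp: pool_def)
qed

lemma reachable_after_take:
  assumes "reachable t s"
  shows "reachable (Suc t) (after_take (Suc t) s)"
proof -
  have h: "holder s g \<noteq> None \<longleftrightarrow> 0 < g \<and> g \<le> t"
    and le: "holder s g = Some p \<Longrightarrow> p \<le> called s" for g p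
    using assms unfolding reachable_def by blast+
  have inj: "inj_on (holder s) {1..t}" and nm: "Some (mover s) \<notin> holder s ` {1..t}"
    and mover: "mover s \<le> called s"
    using assms unfolding reachable_def by (blast, metis imageE, blast)
  have ins: "{1..Suc t} = insert (Suc t) {1..t}"
    by auto
  let ?h = "(holder s)(Suc t := Some (mover s))"
  have "inj_on ?h {1..Suc t}"
    unfolding ins inj_on_insert using nm inj_on_fun_updI[OF inj nm] by auto
  moreover have "?h g \<noteq> None \<longleftrightarrow> 0 < g \<and> g \<le> Suc t" for g
    using h[of g] by (cases "g = Suc t") auto
  moreover have "p \<le> Suc (called s) \<and> p \<noteq> Suc (called s)" if "?h g = Some p" for g p
    using that le[of g p] mover by (cases "g = Suc t") auto
  moreover have "holder (after_take (Suc t) s) = ?h" "mover (after_take (Suc t) s) = Suc (called s)"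
    "called (after_take (Suc t) s) = Suc (called s)"
    by (simp_all add: after_take_def)
  ultimately show ?thesis
    unfolding reachable_def by (metis order_refl)
qed

text \<open>The victim held only the stolen gift, because distinct gifts have distinct holders; so the
  next mover again holds nothing.\<close>

lemma reachable_after_steal:
  assumes "reachable t s" "holder s g = Some p"
  shows "reachable t (after_steal g p s)"
proof -
  have h: "holder s x \<noteq> None \<longleftrightarrow> 0 < x \<and> x \<le> t"
    and le: "holder s x = Some q \<Longrightarrow> q \<le> called s" for x q
    using assms unfolding reachable_def by blast+
  have inj: "inj_on (holder s) {1..t}" and nm: "Some (mover s) \<notin> holder s ` {1..t}"
    and mover: "mover s \<le> called s" "mover s \<noteq> p"
    using assms unfolding reachable_def by (blast, metis imageE, blast, blast)
  have other: "holder s x \<noteq> Some p" if "x \<noteq> g" for x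
  proof
    assume "holder s x = Some p"
    then have "x \<in> {1..t}" "g \<in> {1..t}"
      using h[of x] h[of g] assms(2) by auto
    then show False
      using inj_onD[OF inj, of x g] \<open>holder s x = Some p\<close> assms(2) that by simp
  qed
  let ?h = "(holder s)(g := Some (mover s))"
  have "inj_on ?h {1..t}"
    using inj nm by (rule inj_on_fun_updI)
  moreover have "?h x \<noteq> None \<longleftrightarrow> 0 < x \<and> x \<le> t" for x
    using h[of x] h[of g] assms(2) by (cases "x = g") auto
  moreover have "q \<le> called s \<and> q \<noteq> p" if "?h x = Some q" for x q
    using that le[of x q] other[of x] mover by (cases "x = g") auto
  moreover have "holder (after_steal g p s) = ?h" "mover (after_steal g p s) = p"
    "called (after_steal g p s) = called s"
    by (simp_all add: after_steal_def)
  ultimately show ?thesis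
    unfolding reachable_def using le[OF assms(2)] by metis
qed

lemma pool_order_simps:
  "pool_order [] = []"
  "pool_order (Take p g # ms) = g # pool_order ms"
  "pool_order (Steal p g # ms) = pool_order ms"
  by (simp_all add: pool_order_def)

text \<open>Under the invariant no victim equals the mover, and the prescribed pool order leaves
  \<open>Suc t\<close> as the only gift to take. Hence the state matters only through
  \<open>t\<close> and the steal counts.\<close>

lemma complete_play_play_iff:
  assumes "reachable t s" "t \<le> m"
  shows "complete_play \<sigma> m s (play s w) \<and> pool_order (play s w) = [Suc t..<Suc m] \<longleftrightarrow>
         legal \<sigma> m t (steals s) w"
  using assms
proof (induction w arbitrary: s t)
  case Nil
  then show ?case
    by (auto simp: complete_play_Nil pool_reachable pool_order_simps)
next
  case (Cons g w)
  note pool = pool_reachable[OF Cons.prems(1)]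
  have h: "holder s x \<noteq> None \<longleftrightarrow> 0 < x \<and> x \<le> t" for x
    using Cons.prems by (auto simp: reachable_def)
  show ?case
  proof (cases "holder s g")
    case None
    show ?thesis
    proof (cases "g = Suc t \<and> t < m")
      case True
      have st: "steals (after_take (Suc t) s) = steals s"
        by (simp add: after_take_def)
      from True show ?thesis
        using None Cons.IH[OF reachable_after_take[OF Cons.prems(1)]]
        by (auto simp: complete_play_Take pool pool_order_simps upt_conv_Cons[of "Suc t"] st
            simp del: upt_Suc)
    next
      \<comment> \<open>Both sides fail: \<open>g\<close> is still wrapped or no gift at all, and it
        is not the gift that the pool order demands next.\<close>
      case False
      then show ?thesis
        using None h[of g] Cons.prems(2)
        by (auto simp: complete_play_Take pool pool_order_simps eq_commute[of _ "upt _ _"] upt_eq_Cons_conv simp del: upt_Suc)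
    qed
  next
    case (Some p)
    have st: "steals (after_steal g p s) = (steals s)(g := steals s g + 1)"
      by (simp add: after_steal_def)
    have "p \<noteq> mover s"
      using Some Cons.prems by (auto simp: reachable_def)
    then show ?thesis
      using Some h[of g] Cons.prems(2)
        Cons.IH[OF reachable_after_steal[OF Cons.prems(1) Some] Cons.prems(2)]
      by (auto simp: complete_play_Steal pool pool_order_simps st simp del: upt_Suc fun_upd_apply)
  qed
qed

text \<open>Forgetting the players loses nothing: \<open>map gift\<close> and
  \<open>play initial_state\<close> are mutually inverse between the counted scenarios and the legal
  words.\<close>

lemma G_eq_card_legal: "G \<sigma> n = card {w. legal \<sigma> (n + 1) 0 (\<lambda>_. 0) w}"
proof -
  let ?A = "{ms \<in> scenarios \<sigma> (n + 1). pool_order ms = [1..<n + 2]}"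
  have reach: "reachable 0 initial_state" and st: "steals initial_state = (\<lambda>_. 0)"
    by (auto simp: reachable_def initial_state_def)
  have *: "play initial_state w \<in> ?A \<longleftrightarrow> legal \<sigma> (n + 1) 0 (\<lambda>_. 0) w" for w
    using complete_play_play_iff[OF reach, of "n + 1" \<sigma> w]
    by (simp add: scenarios_def st del: upt_Suc)
  have inv: "ms = play initial_state (map gift ms)" if "ms \<in> ?A" for ms
    using that complete_play_eq_play by (auto simp: scenarios_def)
  have legal: "legal \<sigma> (n + 1) 0 (\<lambda>_. 0) (map gift ms)" if "ms \<in> ?A" for ms
    using that inv[OF that] * by metis
  have "bij_betw (map gift) ?A {w. legal \<sigma> (n + 1) 0 (\<lambda>_. 0) w}"
    by (rule bij_betw_byWitness[where f' = "play initial_state"])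
       (use * inv legal in \<open>auto simp del: upt_Suc\<close>)
  then show ?thesis
    unfolding G_def by (rule bij_betw_same_card)
qed

section \<open>Restricted growth words\<close>

text \<open>For \<open>t = 0\<close> and positive letters these are the restricted growth strings. A
  general \<open>t\<close> treats the letters up to \<open>t\<close> as already seen, which permits
  induction along the word.\<close>

definition restricted_growth :: "nat \<Rightarrow> nat list \<Rightarrow> bool" where
  "restricted_growth t w \<longleftrightarrow> (\<forall>i<length w. {t<..<w ! i} \<subseteq> set (take i w))"

lemma restricted_growth_Nil [simp]: "restricted_growth t []"
  by (simp add: restricted_growth_def)

lemma restricted_growthD:
  "restricted_growth t w \<Longrightarrow> i < length w \<Longrightarrow> t < v \<Longrightarrow> v < w ! i \<Longrightarrow> v \<in> set (take i w)"
  by (auto simp: restricted_growth_def subset_iff)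

lemma restricted_growth_Cons:
  "restricted_growth t (g # w) \<longleftrightarrow> g \<le> Suc t \<and> restricted_growth (max t g) w"
proof -
  have "restricted_growth t (g # w) \<longleftrightarrow>
      {t<..<g} = {} \<and> (\<forall>i<length w. {t<..<w ! i} \<subseteq> insert g (set (take i w)))"
    unfolding restricted_growth_def by (simp add: All_less_Suc2)
  also have "{t<..<g} = {} \<longleftrightarrow> g \<le> Suc t"
    by (auto simp: set_eq_iff)
  also have "g \<le> Suc t \<and> (\<forall>i<length w. {t<..<w ! i} \<subseteq> insert g (set (take i w))) \<longleftrightarrow>
      g \<le> Suc t \<and> restricted_growth (max t g) w"
  proof (intro conj_cong refl)
    assume "g \<le> Suc t"
    \<comment> \<open>Raising the bound from \<open>t\<close> to \<open>max t g\<close> can only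
      drop the letter \<open>g\<close>, which has just been read.\<close>
    then have "{max t g<..<x} = {t<..<x} - {g}" for x
      by auto
    then have "{t<..<x} \<subseteq> insert g A \<longleftrightarrow> {max t g<..<x} \<subseteq> A" for x A
      by auto
    then show "(\<forall>i<length w. {t<..<w ! i} \<subseteq> insert g (set (take i w))) \<longleftrightarrow>
        restricted_growth (max t g) w"
      by (simp add: restricted_growth_def)
  qed
  finally show ?thesis .
qed

section \<open>Legal words in terms of restricted growth and multiplicities\<close>

text \<open>The count of unwrapped gifts rises by one with each take, and the word stops once it is
  \<open>m\<close>; so the last letter is the take of gift \<open>m\<close>.\<close>

lemma legal_snocE:
  assumes "legal \<sigma> m t c w" "t < m"
  obtains u where "w = u @ [m]"
proof -
  have "\<exists>u. w = u @ [m]"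
    using assms
  proof (induction w arbitrary: t c)
    case (Cons g w)
    show ?case
    proof (cases "w = []")
      case True
      then show ?thesis using Cons.prems by auto
    next
      case False
      obtain t' c' where "legal \<sigma> m t' c' w"
        using Cons.prems by auto
      moreover from this have "t' < m"
        using False by (cases w) auto
      ultimately obtain u where "w = u @ [m]"
        using Cons.IH by blast
      then have "g # w = (g # u) @ [m]"
        by simp
      then show ?thesis
        by blast
    qed
  qed simp
  then show ?thesis using that by blast
qed

text \<open>Induction over \<open>u\<close> with \<open>t\<close> and \<open>c\<close> general. A
  letter above \<open>t\<close> spends its first occurrence on the take, hence the extra 1 in its
  bound; every other occurrence is a steal.\<close>

lemma legal_snoc_iff:
  assumes "t < m" "\<And>g. c g \<le> \<sigma>" "\<And>g. t < g \<Longrightarrow> c g = 0"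
  shows "legal \<sigma> m t c (u @ [m]) \<longleftrightarrow>
    restricted_growth t u \<and> {t<..<m} \<subseteq> set u \<and> set u \<subseteq> {0<..<m} \<and>
    (\<forall>g. c g + count_list u g \<le> \<sigma> + (if t < g then 1 else 0))"
  using assms
proof (induction u arbitrary: t c)
  case Nil
  have "{t<..<m} = {} \<longleftrightarrow> Suc t = m"
    using Nil(1) by (auto simp: set_eq_iff)
  then show ?case using Nil by auto
next
  case (Cons g u)
  consider "g = Suc t" "Suc t < m" | "0 < g" "g \<le> t" | "Suc t < g \<or> g = 0 \<or> m \<le> g"
    using Cons.prems(1) by linarith
  then show ?case
  proof cases
    case 1
    have IH: "legal \<sigma> m (Suc t) c (u @ [m]) \<longleftrightarrow>
      restricted_growth (Suc t) u \<and> {Suc t<..<m} \<subseteq> set u \<and> set u \<subseteq> {0<..<m} \<and>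
      (\<forall>x. c x + count_list u x \<le> \<sigma> + (if Suc t < x then 1 else 0))"
      using 1 Cons.prems by (intro Cons.IH) auto
    have "{t<..<m} = insert (Suc t) {Suc t<..<m}"
      using 1 by auto
    \<comment> \<open>Only \<open>x = Suc t\<close> changes: this take uses up the extra 1 of its
      letter.\<close>
    moreover have "(c x + count_list u x \<le> \<sigma> + (if Suc t < x then 1 else 0)) \<longleftrightarrow>
        (c x + count_list (g # u) x \<le> \<sigma> + (if t < x then 1 else 0))" for x
      using 1 Cons.prems by auto
    ultimately show ?thesis
      using 1 IH by (auto simp: restricted_growth_Cons simp del: count_list.simps)
  next
    case 2
    let ?c = "c(g := c g + 1)"
    \<comment> \<open>A steal moves one occurrence of \<open>g\<close> from the word into
      \<open>c\<close>, so the sums stay the same.\<close>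
    have count: "(?c x + count_list u x \<le> \<sigma> + (if t < x then 1 else 0)) \<longleftrightarrow>
        (c x + count_list (g # u) x \<le> \<sigma> + (if t < x then 1 else 0))" for x
      by auto
    have max: "max t g = t" and sub: "{t<..<m} \<subseteq> set (g # u) \<longleftrightarrow> {t<..<m} \<subseteq> set u"
      using 2 by auto
    show ?thesis
    proof (cases "c g < \<sigma>")
      case True
      have IH: "legal \<sigma> m t ?c (u @ [m]) \<longleftrightarrow>
        restricted_growth t u \<and> {t<..<m} \<subseteq> set u \<and> set u \<subseteq> {0<..<m} \<and>
        (\<forall>x. ?c x + count_list u x \<le> \<sigma> + (if t < x then 1 else 0))"
        using 2 True Cons.prems by (intro Cons.IH) (auto simp: Suc_le_eq)
      show ?thesis
        using 2 True IH Cons.prems(1) unfolding count sub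
        by (auto simp: restricted_growth_Cons max simp del: count_list.simps fun_upd_apply)
    next
      case False
      then have "\<not> c g + count_list (g # u) g \<le> \<sigma> + (if t < g then 1 else 0)"
        using 2 by auto
      then show ?thesis
        using 2 False by (auto simp del: count_list.simps intro!: exI[of _ g])
    qed
  next
    case 3
    \<comment> \<open>The take \<open>g = m\<close> would end the game, yet at least the final
      \<open>m\<close> still follows; hence the case split on \<open>u\<close>.\<close>
    moreover have "\<not> legal \<sigma> m t c ((g # u) @ [m])"
      using 3 Cons.prems(1) by (cases u) auto
    ultimately show ?thesis
      by (auto simp: restricted_growth_Cons)
  qed
qed

text \<open>The words, of all lengths, that encode partitions into \<open>n\<close> blocks of size
  at most \<open>h\<close>.\<close>

definition growth_words :: "nat \<Rightarrow> nat \<Rightarrow> nat list set" where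
  "growth_words h n = {w. restricted_growth 0 w \<and> set w = {1..n} \<and> (\<forall>g. count_list w g \<le> h)}"

lemma G_eq_card_growth_words: "G \<sigma> n = card (growth_words (\<sigma> + 1) n)"
proof -
  have "legal \<sigma> (n + 1) 0 (\<lambda>_. 0) (u @ [n + 1]) \<longleftrightarrow> u \<in> growth_words (\<sigma> + 1) n" for u
  proof -
    have interval: "{0<..<n + 1} = {1..n}" by auto
    have "legal \<sigma> (n + 1) 0 (\<lambda>_. 0) (u @ [n + 1]) \<longleftrightarrow> restricted_growth 0 u \<and> set u = {1..n} \<and>
        (\<forall>g. count_list u g \<le> \<sigma> + (if 0 < g then 1 else 0))"
      by (subst legal_snoc_iff) (simp_all only: interval add_0 set_eq_subset, simp_all, blast)
    \<comment> \<open>The two bounds differ only at the letter 0, which does not occur in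
      \<open>u\<close>.\<close>
    moreover have "(\<forall>g. count_list u g \<le> \<sigma> + (if 0 < g then 1 else 0)) \<longleftrightarrow>
        (\<forall>g. count_list u g \<le> \<sigma> + 1)" if "set u = {1..n}"
    proof -
      have "count_list u 0 = 0"
        using that by simp
      then have "count_list u g \<le> \<sigma> + (if 0 < g then 1 else 0) \<longleftrightarrow> count_list u g \<le> \<sigma> + 1" for g
        by (cases "g = 0") auto
      then show ?thesis by blast
    qed
    ultimately show ?thesis
      unfolding growth_words_def mem_Collect_eq by blast
  qed
  moreover have "\<exists>u. w = u @ [n + 1]" if "legal \<sigma> (n + 1) 0 (\<lambda>_. 0) w" for w
    using that by (rule legal_snocE) auto
  ultimately have "{w. legal \<sigma> (n + 1) 0 (\<lambda>_. 0) w} = (\<lambda>u. u @ [n + 1]) ` growth_words (\<sigma> + 1) n"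
    by blast
  then show ?thesis
    by (simp add: G_eq_card_legal card_image inj_on_def)
qed

text \<open>Each of the \<open>n\<close> letters occurs at least once and at most \<open>h\<close>
  times. This yields the limits of the sum in the theorem.\<close>

lemma length_growth_words:
  assumes "w \<in> growth_words h n"
  shows "n \<le> length w" "length w \<le> h * n"
proof -
  have w: "set w = {1..n}" "\<And>g. count_list w g \<le> h"
    using assms by (auto simp: growth_words_def)
  show "n \<le> length w"
    using card_length[of w] w by simp
  have "length w = (\<Sum>g\<in>{1..n}. count_list w g)"
    using sum_count_set[of w "{1..n}"] w by simp
  also have "\<dots> \<le> of_nat (card {1..n}) * h"
    by (rule sum_bounded_above) (use w in auto)
  finally show "length w \<le> h * n" by (simp add: mult.commute)
qed

section \<open>Restricted growth words and set partitions\<close>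

text \<open>A restricted growth word is determined by which of its positions carry equal letters. At
  a first disagreement, the smaller letter has occurred earlier in the word with the larger one,
  where both words still agree.\<close>

lemma restricted_growth_eqI:
  assumes "restricted_growth 0 w" "restricted_growth 0 w'"
    and "length w = length w'" "0 \<notin> set w" "0 \<notin> set w'"
    and ker: "\<And>i j. i < length w \<Longrightarrow> j < length w \<Longrightarrow> w ! i = w ! j \<longleftrightarrow> w' ! i = w' ! j"
  shows "w = w'"
proof (rule nth_equalityI)
  fix i assume "i < length w"
  then show "w ! i = w' ! i"
  proof (induction i rule: less_induct)
    case (less i)
    have i: "i < length w'" using less.prems assms(3) by simp
    have pos: "0 < w ! i" "0 < w' ! i"
      using less.prems i assms(4,5) by (metis nth_mem neq0_conv)+
    have False if "w ! i < w' ! i"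
    proof -
      have "w ! i \<in> set (take i w')"
        using restricted_growthD[OF assms(2) i] pos that by simp
      then obtain j where "j < i" "w' ! j = w ! i"
        using i by (auto simp: in_set_conv_nth)
      \<comment> \<open>By induction \<open>w ! j = w' ! j = w ! i\<close>, so \<open>ker\<close>
        forces \<open>w' ! i = w' ! j\<close>, which is the smaller letter.\<close>
      then show False
        using less ker[of i j] that by auto
    qed
    moreover have False if "w' ! i < w ! i"
    proof -
      have "w' ! i \<in> set (take i w)"
        using restricted_growthD[OF assms(1) less.prems] pos that by simp
      then obtain j where "j < i" "w ! j = w' ! i"
        using less.prems by (auto simp: in_set_conv_nth)
      then show False
        using less ker[of i j] that by auto
    qed
    ultimately show ?case by (meson linorder_neqE_nat)
  qed
qed (use assms in auto)

text \<open>Positions are counted from \<open>1\<close> here.\<close>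

definition positions :: "nat list \<Rightarrow> nat \<Rightarrow> nat set" where
  "positions w g = {i \<in> {1..length w}. w ! (i - 1) = g}"

lemma positions_eq_image: "positions w g = Suc ` {i. i < length w \<and> w ! i = g}"
proof -
  have "i \<in> Suc ` {i. i < length w \<and> w ! i = g}" if "i \<in> positions w g" for i
    using that by (intro image_eqI[of _ _ "i - 1"]) (auto simp: positions_def)
  then show ?thesis by (auto simp: positions_def)
qed

lemma card_positions: "card (positions w g) = count_list w g"
proof -
  have "{i. i < length w \<and> w ! i = g} = {i. i < length w \<and> g = w ! i}" by auto
  then show ?thesis
    by (simp add: positions_eq_image card_image count_list_eq_length_filter length_filter_conv_card)
qed

lemma positions_nonempty: "g \<in> set w \<longleftrightarrow> positions w g \<noteq> {}"
  by (auto simp: positions_eq_image in_set_conv_nth)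

lemma inj_on_positions: "inj_on (positions w) (set w)"
proof (rule inj_onI)
  fix a b assume "a \<in> set w" "positions w a = positions w b"
  moreover obtain i where "i \<in> positions w a"
    using \<open>a \<in> set w\<close> positions_nonempty by blast
  ultimately have "i \<in> positions w a" "i \<in> positions w b" by auto
  then show "a = b" by (auto simp: positions_def)
qed

lemma partition_on_positions: "partition_on {1..length w} (positions w ` set w)"
proof (rule partition_onI)
  show "\<Union> (positions w ` set w) = {1..length w}"
    by (auto simp: positions_def intro!: nth_mem)
  show "disjnt p q" if "p \<in> positions w ` set w" "q \<in> positions w ` set w" "p \<noteq> q" for p q
    using that by (auto simp: positions_def disjnt_def)
  show "{} \<notin> positions w ` set w"
    using positions_nonempty by blast
qed

text \<open>The set of blocks alone decides which positions carry equal letters, as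
  \<open>restricted_growth_eqI\<close> requires.\<close>

lemma nth_eq_iff_positions:
  assumes "i < length w" "j < length w"
  shows "w ! i = w ! j \<longleftrightarrow> (\<exists>B\<in>positions w ` set w. Suc i \<in> B \<and> Suc j \<in> B)"
  using assms by (auto simp: positions_def)

text \<open>Number the blocks by increasing minimum and write at each position the number of its
  block. A smaller number then belongs to a block with a smaller minimum, so it has appeared
  before.\<close>

lemma ex_growth_word:
  assumes P: "partition_on {1..k} P"
  obtains w where "length w = k" "restricted_growth 0 w" "set w = {1..card P}"
    "positions w ` set w = P"
proof -
  have finP: "finite P"
    using P finite_elements by blast
  have un: "\<Union>P = {1..k}" and ne: "\<And>B. B \<in> P \<Longrightarrow> B \<noteq> {}"
    using P by (auto simp: partition_on_def)
  have fin: "finite B" if "B \<in> P" for B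
    using un that by (metis Union_upper finite_atLeastAtMost finite_subset)
  have uniq: "B = C" if "B \<in> P" "C \<in> P" "x \<in> B" "x \<in> C" for x B C
    using P that by (auto simp: partition_on_def disjoint_def)
  have Min_in: "Min B \<in> B" if "B \<in> P" for B
    using that fin ne by simp
  define rank where "rank B = card {C \<in> P. Min C \<le> Min B}" for B
  have rank_less: "rank B < rank C" if "B \<in> P" "C \<in> P" "Min B < Min C" for B C
  proof -
    have "C \<in> {A \<in> P. Min A \<le> Min C} - {A \<in> P. Min A \<le> Min B}"
      using that by simp
    moreover have "{A \<in> P. Min A \<le> Min B} \<subseteq> {A \<in> P. Min A \<le> Min C}"
      using that by auto
    ultimately show ?thesis
      unfolding rank_def using finP by (intro psubset_card_mono) auto
  qed
  have less_rank: "Min B < Min C" if "B \<in> P" "C \<in> P" "rank B < rank C" for B C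
  proof (rule ccontr)
    assume "\<not> Min B < Min C"
    then have "rank C \<le> rank B"
      unfolding rank_def using finP by (intro card_mono) auto
    then show False using that by simp
  qed
  have inj: "inj_on rank P"
  proof (rule inj_onI)
    fix B C assume BC: "B \<in> P" "C \<in> P" "rank B = rank C"
    \<comment> \<open>The common minimum lies in both blocks, and distinct blocks are
      disjoint.\<close>
    then have "Min B = Min C"
      using rank_less by (metis linorder_neqE_nat nat_neq_iff)
    then show "B = C"
      using BC Min_in uniq by metis
  qed
  have "rank ` P \<subseteq> {1..card P}"
  proof
    fix r assume "r \<in> rank ` P"
    then obtain B where B: "B \<in> P" "r = rank B" by auto
    have "card {C \<in> P. Min C \<le> Min B} \<le> card P"
      using finP by (intro card_mono) auto
    moreover have "card {C \<in> P. Min C \<le> Min B} > 0"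
      using finP B by (auto simp: card_gt_0_iff)
    ultimately show "r \<in> {1..card P}"
      using B by (simp add: rank_def)
  qed
  \<comment> \<open>An injective map into a set of the same finite size is onto.\<close>
  then have rank_image: "rank ` P = {1..card P}"
    using inj by (intro card_subset_eq) (auto simp: card_image)
  define block where "block i = (THE B. B \<in> P \<and> i \<in> B)" for i
  have block_eq: "block i = B" if "B \<in> P" "i \<in> B" for i B
    unfolding block_def using that uniq by (intro the_equality) auto
  have block: "block i \<in> P" "i \<in> block i" if "i \<in> {1..k}" for i
  proof -
    obtain B where "B \<in> P" "i \<in> B"
      using \<open>i \<in> {1..k}\<close> un by blast
    then show "block i \<in> P" "i \<in> block i"
      using block_eq by auto
  qed
  define w where "w = map (rank \<circ> block) [1..<Suc k]"
  have len: "length w = k"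
    by (simp add: w_def)
  have nth: "w ! i = rank (block (Suc i))" if "i < k" for i
    using that by (simp add: w_def del: upt_Suc)
  have pos: "positions w (rank B) = B" if "B \<in> P" for B
  proof -
    have "i \<in> positions w (rank B) \<longleftrightarrow> i \<in> B" for i
    proof -
      have "i \<in> positions w (rank B) \<longleftrightarrow> i \<in> {1..k} \<and> rank (block i) = rank B"
        by (auto simp: positions_def len nth)
      also have "\<dots> \<longleftrightarrow> i \<in> {1..k} \<and> block i = B"
        using that block(1) inj_on_eq_iff[OF inj] by blast
      also have "\<dots> \<longleftrightarrow> i \<in> B"
        using that block(2) block_eq un by blast
      finally show ?thesis .
    qed
    then show ?thesis by auto
  qed
  have set_w: "set w = rank ` P"
  proof -
    have "r \<in> set w \<longleftrightarrow> r \<in> rank ` P" for r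
    proof
      assume "r \<in> set w"
      then show "r \<in> rank ` P"
        using block by (auto simp: in_set_conv_nth len nth)
    next
      assume "r \<in> rank ` P"
      then show "r \<in> set w"
        using pos ne positions_nonempty by force
    qed
    then show ?thesis by auto
  qed
  have "restricted_growth 0 w"
    unfolding restricted_growth_def
  proof (intro allI impI subsetI)
    fix i v assume i: "i < length w" and v: "v \<in> {0<..<w ! i}"
    let ?B = "block (Suc i)"
    have B: "?B \<in> P" "Suc i \<in> ?B"
      using block[of "Suc i"] i len by auto
    have "w ! i \<in> {1..card P}"
      using i set_w rank_image nth_mem by blast
    then have "v \<in> rank ` P"
      using v rank_image by auto
    then obtain C where C: "C \<in> P" "v = rank C" by auto
    have "Min C < Min ?B"
      using less_rank[OF C(1) B(1)] C v i len nth by auto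
    also have "Min ?B \<le> Suc i"
      using B fin by simp
    finally have less: "Min C < Suc i" .
    have C_pos: "Min C \<in> positions w v"
      using C Min_in pos by simp
    \<comment> \<open>The minimum is a position counted from 1, list indices start at 0; the witness
      is therefore \<open>Min C - 1\<close>.\<close>
    then have "Min C - 1 < i" "w ! (Min C - 1) = v"
      using less by (auto simp: positions_def)
    then show "v \<in> set (take i w)"
      using i by (auto simp: in_set_conv_nth intro!: exI[of _ "Min C - 1"])
  qed
  moreover have "positions w ` set w = P"
    using pos by (simp add: set_w image_image)
  moreover have "set w = {1..card P}"
    using set_w rank_image by (rule trans)
  ultimately show ?thesis
    using that[OF len] by simp
qed

text \<open>Mapping a word to its blocks is injective because the blocks determine the word, and
  onto by \<open>ex_growth_word\<close>. Letters correspond to blocks and multiplicities to block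
  sizes.\<close>

lemma S2_eq_card_growth_words: "S2 h k n = card {w \<in> growth_words h n. length w = k}"
proof -
  let ?W = "{w \<in> growth_words h n. length w = k}"
  let ?P = "{P. partition_on {1..k} P \<and> card P = n \<and> (\<forall>B\<in>P. card B \<le> h)}"
  let ?f = "\<lambda>w. positions w ` set w"
  have "inj_on ?f ?W"
  proof (rule inj_onI)
    fix w w' assume w: "w \<in> ?W" "w' \<in> ?W" and eq: "?f w = ?f w'"
    have "w ! i = w ! j \<longleftrightarrow> w' ! i = w' ! j" if "i < length w" "j < length w" for i j
      using that w nth_eq_iff_positions[of i w j] nth_eq_iff_positions[of i w' j] eq by simp
    then show "w = w'"
      using w by (intro restricted_growth_eqI) (auto simp: growth_words_def)
  qed
  moreover have "?f ` ?W = ?P"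
  proof (intro equalityI subsetI)
    fix P assume "P \<in> ?f ` ?W"
    then obtain w where w: "w \<in> ?W" "P = ?f w" by blast
    then have "card P = n"
      by (simp add: card_image[OF inj_on_positions]) (simp add: growth_words_def)
    then show "P \<in> ?P"
      using w partition_on_positions[of w] by (auto simp: growth_words_def card_positions)
  next
    fix P assume P: "P \<in> ?P"
    then obtain w where w: "length w = k" "restricted_growth 0 w" "set w = {1..n}" "?f w = P"
      using ex_growth_word[of k P] by auto
    have "count_list w g \<le> h" for g
    proof (cases "g \<in> set w")
      case True
      then show ?thesis
        using P w(4) by (auto simp flip: card_positions)
    qed (simp add: count_notin)
    then have "w \<in> ?W"
      using w by (simp add: growth_words_def)
    then show "P \<in> ?f ` ?W"
      using w(4) by blast
  qed
  ultimately have "bij_betw ?f ?W ?P"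
    by (simp add: bij_betw_def)
  then show ?thesis
    unfolding S2_def by (rule bij_betw_same_card[symmetric])
qed

section \<open>Classification of the words by length\<close>

theorem theorem1:
  fixes \<sigma> n :: nat
  shows "G \<sigma> n = (\<Sum>k = n..(\<sigma> + 1) * n. S2 (\<sigma> + 1) k n)"
proof -
  let ?W = "\<lambda>k. {w \<in> growth_words (\<sigma> + 1) n. length w = k}"
  have fin: "finite (?W k)" for k
    by (rule finite_subset[OF _ finite_lists_length_eq[of "{1..n}" k]])
       (auto simp: growth_words_def)
  \<comment> \<open>The length bounds put every word into one of these classes, which are disjoint
    because a word has only one length.\<close>
  have "growth_words (\<sigma> + 1) n = (\<Union>k\<in>{n..(\<sigma> + 1) * n}. ?W k)"
    using length_growth_words by fastforce
  then have "G \<sigma> n = card (\<Union>k\<in>{n..(\<sigma> + 1) * n}. ?W k)"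
    by (simp add: G_eq_card_growth_words)
  also have "\<dots> = (\<Sum>k = n..(\<sigma> + 1) * n. card (?W k))"
    using fin by (intro card_UN_disjoint) auto
  finally show ?thesis
    by (simp add: S2_eq_card_growth_words)
qed

end
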